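(* Let $(M,[g])$ be a conformal manifold of dimension $n\ge 3$ with metric bundle $\mathcal G$ and ambient space $\widetilde{\mathcal G}$. Let $P:\mathcal E(0)\to\mathcal E(w)$ be an invariant differential operator with an ambient extension $\widetilde P:\widetilde{\mathcal E}(0)\to\widetilde{\mathcal E}(w)$. For a representative metric $g\in[g]$, choose a positive $t\in\widetilde{\mathcal E}(1)$ such that $t(u^2g)=u$ on $\mathcal G$ (for $u>0$). Then $$Q_g=-\big(\widetilde P\log t\big)\circ g$$ is independent of the choice of the extension of $t$ off $\mathcal G$, and so defines a function on $M$ determined by $g$ (given $\widetilde P$). Moreover, if $P1=0$, then $Q_g$ satisfies the transformation law $$e^{-w\Upsilon}Q_{\widehat g}=Q_g+P_g\Upsilon\qquad\text{whenever }\widehat g=e^{2\Upsilon}g,\ \Upsilon\in C^\infty(M).$$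
   Context: Let $(M,[g])$ be a conformal manifold of signature $(p,q)$, $p+q=n\ge3$. The metric bundle $\mathcal G\subset S^2T^*M$ is the ray bundle over $M$ whose sections are the metrics in $[g]$; it has projection $\pi:\mathcal G\to M$ and dilations $\delta_s(g)=s^2g$, $s>0$. A representative $g\in[g]$ is regarded as a section $g:M\to\mathcal G$. Conformal densities of weight $w$ are $$\mathcal E(w)=\{f\in C^\infty(\mathcal G):\delta_s^*f=s^wf\ \text{for all } s>0\}.$$ A representative $g$ identifies $\mathcal E(w)$ with $C^\infty(M)$ via $f\mapsto f_g=f\circ g$, and $f_{\widehat g}=e^{w\Upsilon}f_g$ when $\widehat g=e^{2\Upsilon}g$. In particular $\mathcal E(0)=C^\infty(M)$. A linear operator $P:\mathcal E(w)\to\mathcal E(w')$ defined by the conformal structure thus gives, for each $g\in[g]$, an operator $P_g$ on $C^\infty(M)$; $P$ is called an invariant differential operator if each $P_g$ is a differential operator. One has $P_{\widehat g}=e^{w'\Upsilon}P_ge^{-w\Upsilon}$. The ambient space is $\widetilde{\mathcal G}=\mathcal G\times(-1,1)$, with $\mathcal G$ identified with $\mathcal G\times\{0\}$ and $\delta_s$ acting on the first factor; $\widetilde{\mathcal E}(w)$ denotes the smooth functions on $\widetilde{\mathcal G}$ (considered near $\mathcal G$) homogeneous of degree $w$ under $\delta_s$. $\widetilde{\mathcal G}$ carries an ambient metric: a pseudo-Riemannian metric $\widetilde g$, defined near $\mathcal G$, with (1) $\iota^*\widetilde g=g_0$, where $\iota:\mathcal G\to\widetilde{\mathcal G}$ is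 the inclusion and $g_0$ is the tautological symmetric 2-tensor on $\mathcal G$; (2) $\delta_s^*\widetilde g=s^2\widetilde g$; (3) $\operatorname{Ric}(\widetilde g)=0$ asymptotically along $\mathcal G$. With $T=\frac{d}{ds}\delta_s|_{s=1}$, the function $\widetilde\rho=\|T\|^2_{\widetilde g}\in\widetilde{\mathcal E}(2)$ is a defining function of $\mathcal G$. An ambient extension of $P:\mathcal E(w)\to\mathcal E(w')$ is a linear differential operator $\widetilde P$ on $\widetilde{\mathcal G}$ that preserves homogeneity, in the sense that $\delta_s^*\circ\widetilde P=s^{w'-w}\,\widetilde P\circ\delta_s^*$ for $s>0$ (so $\widetilde P:\widetilde{\mathcal E}(w)\to\widetilde{\mathcal E}(w')$), such that for $\widetilde f\in\widetilde{\mathcal E}(w)$ the restriction $(\widetilde P\widetilde f)|_{\mathcal G}$ depends only on $f=\widetilde f|_{\mathcal G}$ and equals $Pf$. Being a differential operator, $\widetilde P$ can be applied to $\log t$. *)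

theory Defs
  imports "HOL-Analysis.Analysis"
begin

section \<open>Smooth functions on open subsets of a Euclidean space\<close>

primrec Ck_on :: "nat \<Rightarrow> 'a::euclidean_space set \<Rightarrow> ('a \<Rightarrow> 'b::real_normed_vector) \<Rightarrow> bool" where
  "Ck_on 0 S f \<longleftrightarrow> continuous_on S f"
| "Ck_on (Suc k) S f \<longleftrightarrow>
     f differentiable_on S \<and> (\<forall>v. Ck_on k S (\<lambda>x. frechet_derivative f (at x) v))"

text \<open>Only used for open \<open>S\<close>.\<close>
definition smooth_on :: "'a::euclidean_space set \<Rightarrow> ('a \<Rightarrow> 'b::real_normed_vector) \<Rightarrow> bool" where
  "smooth_on S f \<longleftrightarrow> (\<forall>k. Ck_on k S f)"

text \<open>\<open>pderivs [b\<^sub>1, \<dots>, b\<^sub>k] f = \<partial>\<^bsub>b\<^sub>1\<^esub> \<dots> \<partial>\<^bsub>b\<^sub>k\<^esub> f\<close>.\<close>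
primrec pderivs :: "'e::euclidean_space list \<Rightarrow> ('e \<Rightarrow> real) \<Rightarrow> 'e \<Rightarrow> real" where
  "pderivs [] f x = f x"
| "pderivs (b # bs) f x = frechet_derivative (pderivs bs f) (at x) b"


section \<open>Smooth manifolds\<close>

text \<open>
  A manifold is given by an atlas: a set of charts \<open>(U, \<phi>)\<close>, where only the values of \<open>\<phi>\<close> on the
  domain \<open>U\<close> matter.  The underlying set is the union of the chart domains, and the topology is the
  one determined by the charts.  Functions and tensor fields on a manifold are represented by total
  functions on the ambient type; only their values on the manifold (or on the open set in question)
  are meaningful.
\<close>

type_synonym ('a, 'e) chart = "'a set \<times> ('a \<Rightarrow> 'e)"
type_synonym ('a, 'e) atlas = "('a, 'e) chart set"

definition carrier :: "('a, 'e) atlas \<Rightarrow> 'a set" where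
  "carrier A = (\<Union>c\<in>A. fst c)"

definition chart_inv :: "('a, 'e) chart \<Rightarrow> 'e \<Rightarrow> 'a" where
  "chart_inv c = inv_into (fst c) (snd c)"

definition mfd_topology :: "('a, 'e::euclidean_space) atlas \<Rightarrow> 'a topology" where
  "mfd_topology A =
     topology (\<lambda>W. W \<subseteq> carrier A \<and> (\<forall>c\<in>A. open (snd c ` (W \<inter> fst c))))"

definition smooth_manifold :: "('a, 'e::euclidean_space) atlas \<Rightarrow> bool" where
  "smooth_manifold A \<longleftrightarrow>
     (\<forall>c\<in>A. inj_on (snd c) (fst c) \<and> open (snd c ` fst c)) \<and>
     (\<forall>c\<in>A. \<forall>d\<in>A. open (snd c ` (fst c \<inter> fst d)) \<and>
        smooth_on (snd c ` (fst c \<inter> fst d)) (\<lambda>y. snd d (chart_inv c y))) \<and>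
     Hausdorff_space (mfd_topology A) \<and> second_countable (mfd_topology A)"

lemma openin_mfd_topology:
  assumes "\<And>c. c \<in> A \<Longrightarrow> inj_on (snd c) (fst c)"
  shows "openin (mfd_topology A) W \<longleftrightarrow>
    W \<subseteq> carrier A \<and> (\<forall>c\<in>A. open (snd c ` (W \<inter> fst c)))"
proof -
  let ?P = "\<lambda>W. W \<subseteq> carrier A \<and> (\<forall>c\<in>A. open (snd c ` (W \<inter> fst c)))"
  have "istopology ?P"
    unfolding istopology_def
  proof (intro conjI allI impI)
    fix S T assume S: "?P S" and T: "?P T"
    show "S \<inter> T \<subseteq> carrier A" using S by blast
    show "\<forall>c\<in>A. open (snd c ` (S \<inter> T \<inter> fst c))"
    proof
      fix c assume c: "c \<in> A"
      have "snd c ` (S \<inter> T \<inter> fst c) = snd c ` (S \<inter> fst c) \<inter> snd c ` (T \<inter> fst c)"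
        using assms[OF c] by (auto simp: inj_on_def)
      then show "open (snd c ` (S \<inter> T \<inter> fst c))"
        using S T c by (simp add: open_Int)
    qed
  next
    fix K assume K: "\<forall>S\<in>K. ?P S"
    show "\<Union>K \<subseteq> carrier A" using K by blast
    show "\<forall>c\<in>A. open (snd c ` (\<Union>K \<inter> fst c))"
    proof
      fix c assume c: "c \<in> A"
      have "snd c ` (\<Union>K \<inter> fst c) = (\<Union>S\<in>K. snd c ` (S \<inter> fst c))" by blast
      then show "open (snd c ` (\<Union>K \<inter> fst c))" using K c by auto
    qed
  qed
  then show ?thesis by (simp add: mfd_topology_def topology_inverse')
qed

definition smooth_fun :: "('a, 'e::euclidean_space) atlas \<Rightarrow> 'a set \<Rightarrow> ('a \<Rightarrow> real) \<Rightarrow> bool" where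
  "smooth_fun A W f \<longleftrightarrow>
     (\<forall>c\<in>A. smooth_on (snd c ` (W \<inter> fst c)) (\<lambda>y. f (chart_inv c y)))"

definition smooth_near :: "('a, 'e::euclidean_space) atlas \<Rightarrow> 'a \<Rightarrow> ('a \<Rightarrow> real) \<Rightarrow> bool" where
  "smooth_near A x f \<longleftrightarrow> (\<exists>W. openin (mfd_topology A) W \<and> x \<in> W \<and> smooth_fun A W f)"


subsection \<open>Linear differential operators\<close>

text \<open>
  \<open>D\<close> is a linear differential operator of finite order, with smooth coefficients, on the open set
  \<open>N\<close>; it is applied to functions that are smooth on some open \<open>W \<subseteq> N\<close>, and the result is meaningful on
  \<open>W\<close>.  Derivatives are indexed by lists of basis vectors rather than by multi-indices; the
  coefficients are then not unique, but the class of operators is the usual one.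
\<close>
definition differential_operator ::
  "('a, 'e::euclidean_space) atlas \<Rightarrow> 'a set \<Rightarrow> (('a \<Rightarrow> real) \<Rightarrow> 'a \<Rightarrow> real) \<Rightarrow> bool" where
  "differential_operator A N D \<longleftrightarrow>
     (\<exists>(m::nat) (a :: ('a, 'e) chart \<Rightarrow> 'e list \<Rightarrow> 'e \<Rightarrow> real).
        (\<forall>c\<in>A. \<forall>bs. smooth_on (snd c ` (N \<inter> fst c)) (a c bs)) \<and>
        (\<forall>W f. openin (mfd_topology A) W \<longrightarrow> W \<subseteq> N \<longrightarrow> smooth_fun A W f \<longrightarrow>
          (\<forall>c\<in>A. \<forall>x\<in>W \<inter> fst c.
             D f x = (\<Sum>bs | set bs \<subseteq> Basis \<and> length bs \<le> m.
                        a c bs (snd c x) * pderivs bs (\<lambda>y. f (chart_inv c y)) (snd c x)))))"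


subsection \<open>Tangent vectors and covariant 2-tensors\<close>

text \<open>
  Tangent vectors at \<open>x\<close> are the directional derivatives in charts, acting on functions that are
  smooth near \<open>x\<close>, with value \<open>0\<close> on other functions so that vectors are equal iff they agree as
  derivations.
\<close>

type_synonym 'a tvec = "('a \<Rightarrow> real) \<Rightarrow> real"
type_synonym 'a form2 = "'a tvec \<Rightarrow> 'a tvec \<Rightarrow> real"

definition coord_vec ::
  "('a, 'e::euclidean_space) atlas \<Rightarrow> ('a, 'e) chart \<Rightarrow> 'a \<Rightarrow> 'e \<Rightarrow> 'a tvec" where
  "coord_vec A c x e =
     (\<lambda>f. if smooth_near A x f
           then frechet_derivative (\<lambda>y. f (chart_inv c y)) (at (snd c x)) e else 0)"

definition tangent_space :: "('a, 'e::euclidean_space) atlas \<Rightarrow> 'a \<Rightarrow> 'a tvec set" where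
  "tangent_space A x = {coord_vec A c x e | c e. c \<in> A \<and> x \<in> fst c}"

text \<open>The differential at \<open>x\<close> of a smooth map \<open>F\<close> into the manifold \<open>B\<close>.\<close>
definition pushforward ::
  "('b, 'f::euclidean_space) atlas \<Rightarrow> ('a \<Rightarrow> 'b) \<Rightarrow> 'a \<Rightarrow> 'a tvec \<Rightarrow> 'b tvec" where
  "pushforward B F x v = (\<lambda>f. if smooth_near B (F x) f then v (\<lambda>y. f (F y)) else 0)"

text \<open>The components of a 2-tensor field in a chart, as a function of the coordinates.\<close>
definition components ::
  "('a, 'e::euclidean_space) atlas \<Rightarrow> ('a, 'e) chart \<Rightarrow> ('a \<Rightarrow> 'a form2) \<Rightarrow> 'e \<Rightarrow> 'e \<Rightarrow> 'e \<Rightarrow> real" where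
  "components A c h y u v =
     (let x = chart_inv c y in h x (coord_vec A c x u) (coord_vec A c x v))"

text \<open>Pseudo-Riemannian metrics on an open subset \<open>N\<close>, extended by \<open>0\<close> to arguments that are not
  pairs of tangent vectors at a point of \<open>N\<close>.\<close>
definition pseudo_riemannian_metric ::
  "('a, 'e::euclidean_space) atlas \<Rightarrow> 'a set \<Rightarrow> ('a \<Rightarrow> 'a form2) \<Rightarrow> bool" where
  "pseudo_riemannian_metric A N h \<longleftrightarrow>
     (\<forall>x v w. \<not> (x \<in> N \<and> v \<in> tangent_space A x \<and> w \<in> tangent_space A x) \<longrightarrow> h x v w = 0) \<and>
     (\<forall>c\<in>A.
        (\<forall>u v. smooth_on (snd c ` (N \<inter> fst c)) (\<lambda>y. components A c h y u v)) \<and>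
        (\<forall>y\<in>snd c ` (N \<inter> fst c).
           bilinear (components A c h y) \<and>
           (\<forall>u v. components A c h y u v = components A c h y v u) \<and>
           (\<forall>u. u \<noteq> 0 \<longrightarrow> (\<exists>v. components A c h y u v \<noteq> 0))))"

definition has_signature ::
  "nat \<Rightarrow> nat \<Rightarrow> ('e::euclidean_space \<Rightarrow> 'e \<Rightarrow> real) \<Rightarrow> bool" where
  "has_signature p q b \<longleftrightarrow> p + q = DIM('e) \<and>
     (\<exists>V W. subspace V \<and> dim V = p \<and> (\<forall>v\<in>V. v \<noteq> 0 \<longrightarrow> b v v > 0) \<and>
            subspace W \<and> dim W = q \<and> (\<forall>w\<in>W. w \<noteq> 0 \<longrightarrow> b w w < 0))"


subsection \<open>Ricci curvature\<close>

text \<open>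
  Curvature of a metric \<open>B y\<close> (\<open>y\<close> in an open subset of a Euclidean space), written with constant
  vector fields \<open>u, v, z\<close>: \<open>christoffel B y u v = \<nabla>\<^sub>u v\<close>, given by the Koszul formula;
  \<open>riemann B y u v z = (\<nabla>\<^sub>u \<nabla>\<^sub>v - \<nabla>\<^sub>v \<nabla>\<^sub>u) z\<close>; and the Ricci tensor is the trace of \<open>u \<mapsto> R(u, v) z\<close>.
\<close>

definition christoffel ::
  "('e::euclidean_space \<Rightarrow> 'e \<Rightarrow> 'e \<Rightarrow> real) \<Rightarrow> 'e \<Rightarrow> 'e \<Rightarrow> 'e \<Rightarrow> 'e" where
  "christoffel B y u v = (THE z. \<forall>w.
     2 * B y z w = frechet_derivative (\<lambda>y. B y v w) (at y) u
                 + frechet_derivative (\<lambda>y. B y u w) (at y) v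
                 - frechet_derivative (\<lambda>y. B y u v) (at y) w)"

definition riemann ::
  "('e::euclidean_space \<Rightarrow> 'e \<Rightarrow> 'e \<Rightarrow> real) \<Rightarrow> 'e \<Rightarrow> 'e \<Rightarrow> 'e \<Rightarrow> 'e \<Rightarrow> 'e" where
  "riemann B y u v z =
     frechet_derivative (\<lambda>y. christoffel B y v z) (at y) u
     - frechet_derivative (\<lambda>y. christoffel B y u z) (at y) v
     + christoffel B y u (christoffel B y v z)
     - christoffel B y v (christoffel B y u z)"

definition ricci ::
  "('e::euclidean_space \<Rightarrow> 'e \<Rightarrow> 'e \<Rightarrow> real) \<Rightarrow> 'e \<Rightarrow> 'e \<Rightarrow> 'e \<Rightarrow> real" where
  "ricci B y v z = (\<Sum>b\<in>Basis. riemann B y b v z \<bullet> b)"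


section \<open>Conformal structures and the metric bundle\<close>

text \<open>\<open>e\<^bsup>2\<Upsilon>\<^esup> g\<close>.\<close>
definition rescale :: "('m \<Rightarrow> real) \<Rightarrow> ('m \<Rightarrow> 'm form2) \<Rightarrow> 'm \<Rightarrow> 'm form2" where
  "rescale \<Upsilon> g = (\<lambda>x v w. exp (2 * \<Upsilon> x) * g x v w)"

text \<open>\<open>C\<close> is the conformal class \<open>[g]\<close> of a metric of signature \<open>(p, q)\<close>.\<close>
definition conformal_structure ::
  "('m, 'e::euclidean_space) atlas \<Rightarrow> nat \<Rightarrow> nat \<Rightarrow> ('m \<Rightarrow> 'm form2) set \<Rightarrow> bool" where
  "conformal_structure A p q C \<longleftrightarrow>
     (\<exists>g. pseudo_riemannian_metric A (carrier A) g \<and>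
          (\<forall>c\<in>A. \<forall>y\<in>snd c ` fst c. has_signature p q (components A c g y)) \<and>
          C = {rescale \<Upsilon> g | \<Upsilon>. smooth_fun A (carrier A) \<Upsilon>})"

text \<open>A point \<open>(x, h)\<close> of the metric bundle consists of \<open>x \<in> M\<close> and \<open>h \<in> S\<^sup>2T\<^sup>*\<^sub>xM\<close>; the projection \<open>\<pi>\<close>
  is \<open>fst\<close>.\<close>
type_synonym 'm mpoint = "'m \<times> 'm form2"

definition metric_bundle ::
  "('m, 'e) atlas \<Rightarrow> ('m \<Rightarrow> 'm form2) set \<Rightarrow> 'm mpoint set" where
  "metric_bundle A C = {(x, g x) | x g. x \<in> carrier A \<and> g \<in> C}"

definition dil :: "real \<Rightarrow> 'm mpoint \<Rightarrow> 'm mpoint" where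
  "dil s z = (fst z, \<lambda>v w. s\<^sup>2 * snd z v w)"

text \<open>The fibre coordinate \<open>s\<close> of \<open>z = s\<^sup>2 g(x)\<close> in the trivialization of \<open>\<G>\<close> given by \<open>g\<close>.\<close>
definition fibre_coord :: "('m \<Rightarrow> 'm form2) \<Rightarrow> 'm mpoint \<Rightarrow> real" where
  "fibre_coord g z = (THE s. 0 < s \<and> z = dil s (fst z, g (fst z)))"

text \<open>The smooth structure on \<open>\<G>\<close> comes from the trivializations
  \<open>\<G> \<cong> M \<times> (0, \<infinity>)\<close> given by the representatives of the conformal class.\<close>
definition bundle_atlas ::
  "('m, 'e::euclidean_space) atlas \<Rightarrow> ('m \<Rightarrow> 'm form2) set \<Rightarrow> ('m mpoint, 'e \<times> real) atlas" where
  "bundle_atlas A C =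
     {(metric_bundle A C \<inter> (fst -` fst c), \<lambda>z. (snd c (fst z), fibre_coord g z)) | c g.
        c \<in> A \<and> g \<in> C}"

definition densities ::
  "('m, 'e::euclidean_space) atlas \<Rightarrow> ('m \<Rightarrow> 'm form2) set \<Rightarrow> real \<Rightarrow> ('m mpoint \<Rightarrow> real) set" where
  "densities A C w =
     {f. smooth_fun (bundle_atlas A C) (metric_bundle A C) f \<and>
         (\<forall>s>0. \<forall>z\<in>metric_bundle A C. f (dil s z) = s powr w * f z)}"

text \<open>The density \<open>f\<close> of weight \<open>w\<close> with \<open>f \<circ> g = u\<close>.\<close>
definition density_of ::
  "real \<Rightarrow> ('m \<Rightarrow> 'm form2) \<Rightarrow> ('m \<Rightarrow> real) \<Rightarrow> 'm mpoint \<Rightarrow> real" where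
  "density_of w g u = (\<lambda>z. fibre_coord g z powr w * u (fst z))"

text \<open>The operator \<open>P\<^sub>g\<close> on \<open>C\<^sup>\<infinity>(M)\<close> induced by \<open>P : \<E>(w) \<rightarrow> \<E>(w')\<close>.\<close>
definition op_at ::
  "real \<Rightarrow> (('m mpoint \<Rightarrow> real) \<Rightarrow> 'm mpoint \<Rightarrow> real) \<Rightarrow> ('m \<Rightarrow> 'm form2) \<Rightarrow> ('m \<Rightarrow> real) \<Rightarrow> 'm \<Rightarrow> real" where
  "op_at w P g u = (\<lambda>x. P (density_of w g u) (x, g x))"

text \<open>The second clause says that \<open>P\<close> is well defined on functions on \<open>\<G>\<close>, i.e. only values on \<open>\<G>\<close>
  matter.\<close>
definition invariant_differential_operator ::
  "('m, 'e::euclidean_space) atlas \<Rightarrow> ('m \<Rightarrow> 'm form2) set \<Rightarrow> real \<Rightarrow> real \<Rightarrow>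
   (('m mpoint \<Rightarrow> real) \<Rightarrow> 'm mpoint \<Rightarrow> real) \<Rightarrow> bool" where
  "invariant_differential_operator A C w w' P \<longleftrightarrow>
     (\<forall>f\<in>densities A C w. P f \<in> densities A C w') \<and>
     (\<forall>f\<in>densities A C w. \<forall>f'\<in>densities A C w.
        (\<forall>z\<in>metric_bundle A C. f z = f' z) \<longrightarrow> (\<forall>z\<in>metric_bundle A C. P f z = P f' z)) \<and>
     (\<forall>f\<in>densities A C w. \<forall>f'\<in>densities A C w. \<forall>a b. \<forall>z\<in>metric_bundle A C.
        P (\<lambda>z. a * f z + b * f' z) z = a * P f z + b * P f' z) \<and>
     (\<forall>g\<in>C. \<exists>D. differential_operator A (carrier A) D \<and>
        (\<forall>u. smooth_fun A (carrier A) u \<longrightarrow> (\<forall>x\<in>carrier A. op_at w P g u x = D u x)))"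


section \<open>The ambient space\<close>

type_synonym 'm apoint = "'m mpoint \<times> real"

definition ambient_space ::
  "('m, 'e) atlas \<Rightarrow> ('m \<Rightarrow> 'm form2) set \<Rightarrow> 'm apoint set" where
  "ambient_space A C = metric_bundle A C \<times> {-1<..<1}"

definition ambient_atlas ::
  "('m, 'e::euclidean_space) atlas \<Rightarrow> ('m \<Rightarrow> 'm form2) set \<Rightarrow>
   ('m apoint, ('e \<times> real) \<times> real) atlas" where
  "ambient_atlas A C =
     {(fst c \<times> {-1<..<1}, \<lambda>(z, r). (snd c z, r)) | c. c \<in> bundle_atlas A C}"

definition adil :: "real \<Rightarrow> 'm apoint \<Rightarrow> 'm apoint" where
  "adil s z = (dil s (fst z), snd z)"

text \<open>Dilation-invariant open neighbourhoods of \<open>\<G> = \<G> \<times> {0}\<close> in the ambient space.  Everything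
  defined ``near \<open>\<G>\<close>'' is defined on such a neighbourhood.\<close>
definition ambient_nbhd ::
  "('m, 'e::euclidean_space) atlas \<Rightarrow> ('m \<Rightarrow> 'm form2) set \<Rightarrow> 'm apoint set \<Rightarrow> bool" where
  "ambient_nbhd A C N \<longleftrightarrow>
     N \<subseteq> ambient_space A C \<and> openin (mfd_topology (ambient_atlas A C)) N \<and>
     metric_bundle A C \<times> {0} \<subseteq> N \<and> (\<forall>s>0. \<forall>z\<in>N. adil s z \<in> N)"

definition ambient_densities ::
  "('m, 'e::euclidean_space) atlas \<Rightarrow> ('m \<Rightarrow> 'm form2) set \<Rightarrow> real \<Rightarrow> ('m apoint \<Rightarrow> real) set" where
  "ambient_densities A C w =
     {f. \<exists>N. ambient_nbhd A C N \<and> smooth_fun (ambient_atlas A C) N f \<and>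
         (\<forall>s>0. \<forall>z\<in>N. f (adil s z) = s powr w * f z)}"

text \<open>The tautological symmetric 2-tensor \<open>g\<^sub>0\<close> on \<open>\<G>\<close>.\<close>
definition tautological_tensor ::
  "('m, 'e::euclidean_space) atlas \<Rightarrow> 'm mpoint \<Rightarrow> 'm mpoint form2" where
  "tautological_tensor A z v w = snd z (pushforward A fst z v) (pushforward A fst z w)"

text \<open>\<open>Ric(h) = O(r\<^sup>k)\<close> along \<open>\<G> = {r = 0}\<close>, where \<open>r\<close> is the coordinate on \<open>(-1, 1)\<close>: each component
  is \<open>r\<^sup>k\<close> times a function smooth up to and across \<open>\<G>\<close>.\<close>
definition ricci_vanishes_to_order ::
  "('m, 'e::euclidean_space) atlas \<Rightarrow> ('m \<Rightarrow> 'm form2) set \<Rightarrow> 'm apoint set \<Rightarrow>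
   ('m apoint \<Rightarrow> 'm apoint form2) \<Rightarrow> nat \<Rightarrow> bool" where
  "ricci_vanishes_to_order A C N h k \<longleftrightarrow>
     (\<forall>c\<in>ambient_atlas A C. \<forall>u v. \<exists>F.
        smooth_on (snd c ` (N \<inter> fst c)) F \<and>
        (\<forall>y\<in>snd c ` (N \<inter> fst c).
           ricci (components (ambient_atlas A C) c h) y u v = snd y ^ k * F y))"

text \<open>
  The last two clauses spell out ``\<open>Ric = 0\<close> asymptotically along \<open>\<G>\<close>'': to infinite order if
  \<open>n = dim M\<close> is odd, and \<open>Ric = O(r\<^bsup>n/2-1\<^esup>)\<close> if \<open>n\<close> is even, in which case the conformal structure
  may obstruct vanishing to higher order.
\<close>
definition ambient_metric ::
  "('m, 'e::euclidean_space) atlas \<Rightarrow> ('m \<Rightarrow> 'm form2) set \<Rightarrow> 'm apoint set \<Rightarrow>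
   ('m apoint \<Rightarrow> 'm apoint form2) \<Rightarrow> bool" where
  "ambient_metric A C N h \<longleftrightarrow>
     ambient_nbhd A C N \<and>
     pseudo_riemannian_metric (ambient_atlas A C) N h \<and>
     (\<forall>z\<in>metric_bundle A C. \<forall>v\<in>tangent_space (bundle_atlas A C) z.
        \<forall>w\<in>tangent_space (bundle_atlas A C) z.
          h (z, 0) (pushforward (ambient_atlas A C) (\<lambda>z. (z, 0)) z v)
                   (pushforward (ambient_atlas A C) (\<lambda>z. (z, 0)) z w)
            = tautological_tensor A z v w) \<and>
     (\<forall>s>0. \<forall>z\<in>N. \<forall>v\<in>tangent_space (ambient_atlas A C) z.
        \<forall>w\<in>tangent_space (ambient_atlas A C) z.
          h (adil s z) (pushforward (ambient_atlas A C) (adil s) z v)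
                       (pushforward (ambient_atlas A C) (adil s) z w)
            = s\<^sup>2 * h z v w) \<and>
     (odd DIM('e) \<longrightarrow> (\<forall>k. ricci_vanishes_to_order A C N h k)) \<and>
     (even DIM('e) \<longrightarrow> ricci_vanishes_to_order A C N h (DIM('e) div 2 - 1))"

text \<open>
  \<open>Pt\<close> is a differential operator on the neighbourhood \<open>N\<close> of \<open>\<G>\<close>.  The second clause is
  \<open>\<delta>\<^sub>s\<^sup>* \<circ> Pt = s\<^bsup>w'-w\<^esup> Pt \<circ> \<delta>\<^sub>s\<^sup>*\<close>, for functions smooth on any open subset of \<open>N\<close>.
\<close>
definition ambient_extension ::
  "('m, 'e::euclidean_space) atlas \<Rightarrow> ('m \<Rightarrow> 'm form2) set \<Rightarrow> 'm apoint set \<Rightarrow> real \<Rightarrow> real \<Rightarrow>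
   (('m mpoint \<Rightarrow> real) \<Rightarrow> 'm mpoint \<Rightarrow> real) \<Rightarrow>
   (('m apoint \<Rightarrow> real) \<Rightarrow> 'm apoint \<Rightarrow> real) \<Rightarrow> bool" where
  "ambient_extension A C N w w' P Pt \<longleftrightarrow>
     differential_operator (ambient_atlas A C) N Pt \<and>
     (\<forall>s>0. \<forall>W f. openin (mfd_topology (ambient_atlas A C)) W \<longrightarrow> W \<subseteq> N \<longrightarrow>
        smooth_fun (ambient_atlas A C) W f \<longrightarrow>
        (\<forall>z\<in>N. adil s z \<in> W \<longrightarrow>
           Pt f (adil s z) = s powr (w' - w) * Pt (\<lambda>y. f (adil s y)) z)) \<and>
     (\<forall>f\<in>densities A C w. \<forall>F\<in>ambient_densities A C w.
        (\<forall>z\<in>metric_bundle A C. F (z, 0) = f z) \<longrightarrow>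
        (\<forall>z\<in>metric_bundle A C. Pt F (z, 0) = P f z))"

definition ambient_scale ::
  "('m, 'e::euclidean_space) atlas \<Rightarrow> ('m \<Rightarrow> 'm form2) set \<Rightarrow> ('m \<Rightarrow> 'm form2) \<Rightarrow>
   ('m apoint \<Rightarrow> real) \<Rightarrow> bool" where
  "ambient_scale A C g t \<longleftrightarrow>
     t \<in> ambient_densities A C 1 \<and>
     (\<exists>N. ambient_nbhd A C N \<and> (\<forall>z\<in>N. t z > 0)) \<and>
     (\<forall>x\<in>carrier A. \<forall>u>0. t (dil u (x, g x), 0) = u)"

definition log_curvature ::
  "(('m apoint \<Rightarrow> real) \<Rightarrow> 'm apoint \<Rightarrow> real) \<Rightarrow> ('m \<Rightarrow> 'm form2) \<Rightarrow> ('m apoint \<Rightarrow> real) \<Rightarrow>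
   'm \<Rightarrow> real" where
  "log_curvature Pt g t x = - Pt (\<lambda>z. ln (t z)) ((x, g x), 0)"

text \<open>\<open>Q\<^sub>g\<close>, computed from an arbitrary choice of \<open>t\<close>.\<close>
definition Q_curvature ::
  "('m, 'e::euclidean_space) atlas \<Rightarrow> ('m \<Rightarrow> 'm form2) set \<Rightarrow>
   (('m apoint \<Rightarrow> real) \<Rightarrow> 'm apoint \<Rightarrow> real) \<Rightarrow> ('m \<Rightarrow> 'm form2) \<Rightarrow> 'm \<Rightarrow> real" where
  "Q_curvature A C Pt g = log_curvature Pt g (SOME t. ambient_scale A C g t)"

end

theory Submission
  imports Defs
begin

text \<open>
  The function \<open>log t\<close> is not homogeneous, but the difference of the logarithms of two scales is
  homogeneous of degree \<open>0\<close>, and so is the constant by which a dilation changes \<open>log t\<close>.  On both of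
  these the extension \<open>Pt\<close> acts, along \<open>\<G>\<close>, as \<open>P\<close> acts on their restrictions to \<open>\<G>\<close>.

  Let \<open>t\<close> and \<open>t'\<close> be scales for \<open>g\<close> and \<open>g' = e\<^bsup>2\<Upsilon>\<^esup> g\<close>.  On \<open>\<G>\<close> they are the fibre coordinates of
  \<open>g\<close> and \<open>g'\<close>, so \<open>log t' - log t\<close> restricts to \<open>-\<Upsilon>\<close>, and on \<open>\<G>\<close> linearity gives
  \<open>Pt (log t') = Pt (log t) - P \<Upsilon>\<close> (\<open>Pt_ln_scale_rescale\<close>).  The case \<open>\<Upsilon> = 0\<close> says that \<open>Q\<^sub>g\<close> does not
  depend on the extension of \<open>t\<close>.  For general \<open>\<Upsilon>\<close> this compares the two functions at the same point
  of \<open>\<G>\<close>, whereas \<open>Q\<^sub>g\<close> and \<open>Q\<^bsub>g'\<^esub>\<close> are read off at the points \<open>g(x)\<close> and \<open>g'(x) = \<delta>\<^sub>s g(x)\<close>, where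
  \<open>s = e\<^bsup>\<Upsilon>(x)\<^esup>\<close>.  If \<open>P 1 = 0\<close>, then the constant by which \<open>\<delta>\<^sub>s\<close> changes \<open>log t\<close> is annihilated, so
  \<open>Pt (log t)\<close> is homogeneous of degree \<open>w\<close> on \<open>\<G>\<close> (\<open>Pt_ln_scale_homogeneous\<close>), as is \<open>P \<Upsilon>\<close>; the
  common factor \<open>e\<^bsup>w\<Upsilon>\<^esup>\<close> is the one in the transformation law.

  The remaining work is differential-geometric: differential operators are local and additive on
  smooth functions, logarithms and differences of smooth functions are smooth, and the fibre
  coordinate of \<open>g\<close>, extended to be constant in the last variable, is a scale.
\<close>

section \<open>Calculus of smooth functions\<close>

lemma has_derivative_on_open:
  assumes "f differentiable_on S" "open S" "x \<in> S"
  shows "(f has_derivative frechet_derivative f (at x)) (at x)"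
  using assms differentiable_on_eq_differentiable_at frechet_derivative_works by blast

lemma frechet_derivative_cong_open:
  assumes "open S" "x \<in> S" "\<And>y. y \<in> S \<Longrightarrow> f y = g y"
  shows "frechet_derivative f (at x) = frechet_derivative g (at x)"
proof -
  have "(f has_derivative D) (at x) \<longleftrightarrow> (g has_derivative D) (at x)" for D
    using assms by (metis has_derivative_transform_within_open)
  then show ?thesis by (simp add: frechet_derivative_def)
qed

lemma Ck_on_SucD: "Ck_on (Suc k) S f \<Longrightarrow> Ck_on k S f"
proof (induction k arbitrary: f)
  case 0
  then show ?case by (simp add: differentiable_imp_continuous_on)
next
  case (Suc k)
  then show ?case by (metis Ck_on.simps(2))
qed

lemma Ck_on_subset: "Ck_on k S f \<Longrightarrow> T \<subseteq> S \<Longrightarrow> Ck_on k T f"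
proof (induction k arbitrary: f)
  case 0
  then show ?case by (simp add: continuous_on_subset)
next
  case (Suc k)
  then show ?case by (auto intro: differentiable_on_subset)
qed

lemma Ck_on_cong:
  assumes "open S"
  shows "(\<And>y. y \<in> S \<Longrightarrow> f y = g y) \<Longrightarrow> Ck_on k S f \<Longrightarrow> Ck_on k S g"
proof (induction k arbitrary: f g)
  case 0
  then show ?case by (metis Ck_on.simps(1) continuous_on_cong)
next
  case (Suc k)
  have "g differentiable_on S"
    using Suc.prems by (metis Ck_on.simps(2) differentiable_on_def differentiable_transform_within zero_less_one)
  moreover have "Ck_on k S (\<lambda>x. frechet_derivative g (at x) v)" for v
    by (rule Suc.IH[of "\<lambda>x. frechet_derivative f (at x) v"])
      (use Suc.prems frechet_derivative_cong_open[OF assms, of _ f g] in auto)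
  ultimately show ?case by simp
qed

text \<open>A function is \<open>C\<^sup>k\<^sup>+\<^sup>1\<close> as soon as some known candidate for its derivative is \<open>C\<^sup>k\<close>; every
  closure property below is an induction on \<open>k\<close> in which the candidate is the usual rule of
  differentiation.\<close>

lemma Ck_on_SucI:
  assumes "open S" "\<And>x. x \<in> S \<Longrightarrow> (f has_derivative D x) (at x)" "\<And>v. Ck_on k S (\<lambda>x. D x v)"
  shows "Ck_on (Suc k) S f"
proof -
  have "f differentiable_on S"
    using assms(1,2) differentiable_def differentiable_on_eq_differentiable_at by blast
  moreover have "Ck_on k S (\<lambda>x. frechet_derivative f (at x) v)" for v
    by (rule Ck_on_cong[OF assms(1) _ assms(3)]) (use frechet_derivative_at[OF assms(2)] in simp)
  ultimately show ?thesis by simp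
qed

lemma Ck_on_const: "open S \<Longrightarrow> Ck_on k S (\<lambda>_. c)"
proof (induction k arbitrary: c)
  case (Suc k)
  then show ?case by (intro Ck_on_SucI[where D = "\<lambda>_ _. 0"]) auto
qed simp

lemma Ck_on_linear: "open S \<Longrightarrow> bounded_linear f \<Longrightarrow> Ck_on k S f"
proof (cases k)
  case (Suc l)
  assume "open S" "bounded_linear f"
  then have "Ck_on (Suc l) S f"
    by (intro Ck_on_SucI[where D = "\<lambda>_. f"] Ck_on_const bounded_linear_imp_has_derivative)
  then show ?thesis by (simp only: Suc)
qed (simp add: linear_continuous_on)

lemma Ck_on_add:
  assumes "open S"
  shows "Ck_on k S f \<Longrightarrow> Ck_on k S g \<Longrightarrow> Ck_on k S (\<lambda>x. f x + g x)"
proof (induction k arbitrary: f g)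
  case 0
  then show ?case by (simp add: continuous_on_add)
next
  case (Suc k)
  show ?case
  proof (rule Ck_on_SucI[OF assms])
    fix x assume "x \<in> S"
    then show "((\<lambda>x. f x + g x) has_derivative
        (\<lambda>v. frechet_derivative f (at x) v + frechet_derivative g (at x) v)) (at x)"
      using Suc.prems assms by (auto intro!: has_derivative_add has_derivative_on_open)
  qed (use Suc in auto)
qed

lemma Ck_on_mult:
  fixes f g :: "'a::euclidean_space \<Rightarrow> real"
  assumes "open S"
  shows "Ck_on k S f \<Longrightarrow> Ck_on k S g \<Longrightarrow> Ck_on k S (\<lambda>x. f x * g x)"
proof (induction k arbitrary: f g)
  case 0
  then show ?case by (simp add: continuous_on_mult)
next
  case (Suc k)
  show ?case
  proof (rule Ck_on_SucI[OF assms])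
    fix x assume "x \<in> S"
    then show "((\<lambda>x. f x * g x) has_derivative
        (\<lambda>v. f x * frechet_derivative g (at x) v + frechet_derivative f (at x) v * g x)) (at x)"
      using Suc.prems assms by (auto intro!: has_derivative_mult has_derivative_on_open)
  next
    fix v
    show "Ck_on k S (\<lambda>x. f x * frechet_derivative g (at x) v + frechet_derivative f (at x) v * g x)"
      using Suc.prems by (intro Ck_on_add Suc.IH assms) (auto simp: Ck_on_SucD simp del: Ck_on.simps(1))
  qed
qed

lemma Ck_on_exp:
  fixes f :: "'a::euclidean_space \<Rightarrow> real"
  assumes "open S"
  shows "Ck_on k S f \<Longrightarrow> Ck_on k S (\<lambda>x. exp (f x))"
proof (induction k)
  case 0
  then show ?case by (simp add: continuous_on_exp)
next
  case (Suc k)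
  show ?case
  proof (rule Ck_on_SucI[OF assms])
    fix x assume "x \<in> S"
    then show "((\<lambda>x. exp (f x)) has_derivative
        (\<lambda>v. exp (f x) * frechet_derivative f (at x) v)) (at x)"
      using has_derivative_exp[OF has_derivative_on_open[of f S x]] Suc.prems assms
      by (simp add: mult.commute)
  next
    fix v
    show "Ck_on k S (\<lambda>x. exp (f x) * frechet_derivative f (at x) v)"
      using Suc.IH[OF Ck_on_SucD[OF Suc.prems]] Suc.prems by (intro Ck_on_mult assms) auto
  qed
qed

text \<open>The derivative of \<open>ln f\<close> is \<open>f' / f\<close>, and writing \<open>1 / f = exp (- ln f)\<close> makes the induction
  close without a separate treatment of reciprocals.\<close>

lemma Ck_on_ln:
  fixes f :: "'a::euclidean_space \<Rightarrow> real"
  assumes "open S" "\<And>x. x \<in> S \<Longrightarrow> f x > 0"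
  shows "Ck_on k S f \<Longrightarrow> Ck_on k S (\<lambda>x. ln (f x))"
proof (induction k)
  case 0
  then show ?case using assms by (force intro: continuous_on_ln)
next
  case (Suc k)
  show ?case
  proof (rule Ck_on_SucI[OF assms(1)])
    fix x assume x: "x \<in> S"
    have "((\<lambda>x. ln (f x)) has_derivative (\<lambda>v. frechet_derivative f (at x) v * inverse (f x))) (at x)"
      using has_derivative_ln[OF assms(2)[OF x] has_derivative_on_open[of f S x]] Suc.prems assms x by simp
    then show "((\<lambda>x. ln (f x)) has_derivative
        (\<lambda>v. exp ((- 1) * ln (f x)) * frechet_derivative f (at x) v)) (at x)"
      using assms(2)[OF x] by (simp add: exp_minus mult.commute)
  next
    fix v
    show "Ck_on k S (\<lambda>x. exp ((- 1) * ln (f x)) * frechet_derivative f (at x) v)"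
      using Suc.IH[OF Ck_on_SucD[OF Suc.prems]] Suc.prems
      by (intro Ck_on_mult Ck_on_exp Ck_on_const assms(1)) auto
  qed
qed

lemma Ck_on_compose_linear:
  assumes "open S" "open T" "bounded_linear L" "L ` T \<subseteq> S"
  shows "Ck_on k S f \<Longrightarrow> Ck_on k T (\<lambda>x. f (L x))"
proof (induction k arbitrary: f)
  case 0
  then show ?case
    using assms by (auto intro: continuous_on_compose2[of S f] linear_continuous_on)
next
  case (Suc k)
  show ?case
  proof (rule Ck_on_SucI[OF assms(2)])
    fix x assume "x \<in> T"
    then have "(f has_derivative frechet_derivative f (at (L x))) (at (L x))"
      using Suc.prems assms by (auto intro!: has_derivative_on_open)
    then show "((\<lambda>x. f (L x)) has_derivative (\<lambda>v. frechet_derivative f (at (L x)) (L v))) (at x)"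
      by (rule has_derivative_compose[OF bounded_linear_imp_has_derivative[OF assms(3)]])
  next
    fix v
    show "Ck_on k T (\<lambda>x. frechet_derivative f (at (L x)) (L v))"
      using Suc.IH[of "\<lambda>x. frechet_derivative f (at x) (L v)"] Suc.prems by simp
  qed
qed

lemma smooth_on_subset: "smooth_on S f \<Longrightarrow> T \<subseteq> S \<Longrightarrow> smooth_on T f"
  unfolding smooth_on_def using Ck_on_subset by blast

lemma smooth_on_const: "open S \<Longrightarrow> smooth_on S (\<lambda>_. c)"
  by (simp add: smooth_on_def Ck_on_const)

lemma smooth_on_linear: "open S \<Longrightarrow> bounded_linear f \<Longrightarrow> smooth_on S f"
  by (simp add: smooth_on_def Ck_on_linear)

lemma smooth_on_cong:
  "open S \<Longrightarrow> smooth_on S f \<Longrightarrow> (\<And>x. x \<in> S \<Longrightarrow> f x = g x) \<Longrightarrow> smooth_on S g"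
  using Ck_on_cong[of S f g] by (simp add: smooth_on_def)

lemma smooth_on_add:
  "open S \<Longrightarrow> smooth_on S f \<Longrightarrow> smooth_on S g \<Longrightarrow> smooth_on S (\<lambda>x. f x + g x)"
  by (simp add: smooth_on_def Ck_on_add)

lemma smooth_on_mult:
  fixes f g :: "'a::euclidean_space \<Rightarrow> real"
  shows "open S \<Longrightarrow> smooth_on S f \<Longrightarrow> smooth_on S g \<Longrightarrow> smooth_on S (\<lambda>x. f x * g x)"
  by (simp add: smooth_on_def Ck_on_mult)

lemma smooth_on_exp:
  fixes f :: "'a::euclidean_space \<Rightarrow> real"
  shows "open S \<Longrightarrow> smooth_on S f \<Longrightarrow> smooth_on S (\<lambda>x. exp (f x))"
  by (simp add: smooth_on_def Ck_on_exp)

lemma smooth_on_ln: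
  fixes f :: "'a::euclidean_space \<Rightarrow> real"
  shows "open S \<Longrightarrow> smooth_on S f \<Longrightarrow> (\<And>x. x \<in> S \<Longrightarrow> f x > 0) \<Longrightarrow> smooth_on S (\<lambda>x. ln (f x))"
  by (simp add: smooth_on_def Ck_on_ln)

lemma smooth_on_compose_linear:
  assumes "open S" "open T" "bounded_linear L" "L ` T \<subseteq> S" "smooth_on S f"
  shows "smooth_on T (\<lambda>x. f (L x))"
  using assms(5) Ck_on_compose_linear[OF assms(1-4)] unfolding smooth_on_def by blast

lemma smooth_on_pderivs:
  assumes "smooth_on S f"
  shows "smooth_on S (pderivs bs f)"
proof (induction bs)
  case Nil
  have "pderivs [] f = f" by auto
  then show ?case using assms by simp
next
  case (Cons b bs)
  have "pderivs (b # bs) f = (\<lambda>x. frechet_derivative (pderivs bs f) (at x) b)" by auto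
  then show ?case using Cons unfolding smooth_on_def by (metis Ck_on.simps(2))
qed

lemma pderivs_cong:
  assumes "open S" "\<And>y. y \<in> S \<Longrightarrow> f y = g y" "x \<in> S"
  shows "pderivs bs f x = pderivs bs g x"
  using assms(3)
proof (induction bs arbitrary: x)
  case (Cons b bs)
  then show ?case
    using frechet_derivative_cong_open[OF assms(1), of x "pderivs bs f" "pderivs bs g"] by simp
qed (use assms in simp)

lemma pderivs_add:
  assumes "open S" "smooth_on S f" "smooth_on S g" "x \<in> S"
  shows "pderivs bs (\<lambda>y. f y + g y) x = pderivs bs f x + pderivs bs g x"
  using assms(4)
proof (induction bs arbitrary: x)
  case (Cons b bs)
  have d: "(pderivs bs k has_derivative frechet_derivative (pderivs bs k) (at x)) (at x)"
    if "smooth_on S k" for k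
    using smooth_on_pderivs[OF that, of bs] has_derivative_on_open assms(1) Cons.prems
    unfolding smooth_on_def by (metis Ck_on.simps(2))
  have "frechet_derivative (pderivs bs (\<lambda>y. f y + g y)) (at x)
      = frechet_derivative (\<lambda>y. pderivs bs f y + pderivs bs g y) (at x)"
    by (rule frechet_derivative_cong_open[OF assms(1) Cons.prems Cons.IH])
  also have "\<dots> = (\<lambda>v. frechet_derivative (pderivs bs f) (at x) v + frechet_derivative (pderivs bs g) (at x) v)"
    using has_derivative_add[OF d[OF assms(2)] d[OF assms(3)]] frechet_derivative_at by metis
  finally show ?case by simp
qed simp


section \<open>Functions and differential operators on a manifold\<close>

definition inj_charts :: "('a, 'e) atlas \<Rightarrow> bool" where
  "inj_charts A \<longleftrightarrow> (\<forall>c\<in>A. inj_on (snd c) (fst c))"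

lemma open_chart_image:
  assumes "inj_charts A" "openin (mfd_topology A) W" "c \<in> A"
  shows "open (snd c ` (W \<inter> fst c))"
  using assms openin_mfd_topology[of A W] by (auto simp: inj_charts_def)

lemma chart_inv_chart:
  assumes "inj_charts A" "c \<in> A" "x \<in> fst c"
  shows "chart_inv c (snd c x) = x"
  using assms by (auto simp: inj_charts_def chart_inv_def)

lemma chart_inv_in:
  assumes "inj_charts A" "c \<in> A" "y \<in> snd c ` (W \<inter> fst c)"
  shows "chart_inv c y \<in> W" "chart_inv c y \<in> fst c" "snd c (chart_inv c y) = y"
  using assms chart_inv_chart by fastforce+

lemma smooth_fun_subset: "smooth_fun A W f \<Longrightarrow> V \<subseteq> W \<Longrightarrow> smooth_fun A V f"
  unfolding smooth_fun_def by (meson Int_mono image_mono smooth_on_subset subset_refl)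

lemma smooth_fun_cong:
  assumes "inj_charts A" "openin (mfd_topology A) W" "smooth_fun A W f"
    and "\<And>x. x \<in> W \<Longrightarrow> f x = g x"
  shows "smooth_fun A W g"
  using assms unfolding smooth_fun_def
  by (metis (no_types, lifting) chart_inv_in(1) open_chart_image smooth_on_cong)

lemma smooth_fun_const:
  assumes "inj_charts A" "openin (mfd_topology A) W"
  shows "smooth_fun A W (\<lambda>_. k)"
  using assms unfolding smooth_fun_def by (simp add: open_chart_image smooth_on_const)

lemma smooth_fun_add:
  assumes "inj_charts A" "openin (mfd_topology A) W" "smooth_fun A W f" "smooth_fun A W g"
  shows "smooth_fun A W (\<lambda>x. f x + g x)"
  using assms unfolding smooth_fun_def by (simp add: open_chart_image smooth_on_add)

lemma smooth_fun_cmult: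
  assumes "inj_charts A" "openin (mfd_topology A) W" "smooth_fun A W f"
  shows "smooth_fun A W (\<lambda>x. k * f x)"
  using assms unfolding smooth_fun_def
  by (simp add: open_chart_image smooth_on_mult smooth_on_const)

lemma smooth_fun_ln:
  assumes "inj_charts A" "openin (mfd_topology A) W" "smooth_fun A W f" "\<And>x. x \<in> W \<Longrightarrow> f x > 0"
  shows "smooth_fun A W (\<lambda>x. ln (f x))"
  unfolding smooth_fun_def
proof
  fix c assume c: "c \<in> A"
  show "smooth_on (snd c ` (W \<inter> fst c)) (\<lambda>y. ln (f (chart_inv c y)))"
    using assms c chart_inv_in(1)[OF assms(1) c]
    by (intro smooth_on_ln open_chart_image) (auto simp: smooth_fun_def)
qed

text \<open>At a given point a single coordinate formula serves all functions that are smooth on \<open>W\<close>.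
  Locality and additivity of \<open>D\<close> are read off from it.\<close>

lemma differential_operator_local_formula:
  assumes "inj_charts A" "differential_operator A N D"
    and W: "openin (mfd_topology A) W" "W \<subseteq> N" "x \<in> W"
  obtains c a m where "c \<in> A" "x \<in> fst c"
    and "\<And>f. smooth_fun A W f \<Longrightarrow>
      D f x = (\<Sum>bs | set bs \<subseteq> Basis \<and> length bs \<le> m.
                 a bs * pderivs bs (\<lambda>y. f (chart_inv c y)) (snd c x))"
proof -
  have "x \<in> carrier A"
    using assms openin_mfd_topology[of A W] by (auto simp: inj_charts_def)
  then obtain c where c: "c \<in> A" "x \<in> fst c" by (auto simp: carrier_def)
  obtain m :: nat and a where "\<forall>W f. openin (mfd_topology A) W \<longrightarrow> W \<subseteq> N \<longrightarrow> smooth_fun A W f \<longrightarrow>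
      (\<forall>c\<in>A. \<forall>x\<in>W \<inter> fst c. D f x = (\<Sum>bs | set bs \<subseteq> Basis \<and> length bs \<le> m.
                 a c bs (snd c x) * pderivs bs (\<lambda>y. f (chart_inv c y)) (snd c x)))"
    using assms(2) unfolding differential_operator_def by (elim exE conjE)
  then show ?thesis
    using c W by (intro that[OF c, of "\<lambda>bs. a c bs (snd c x)" m]) simp
qed

lemma differential_operator_cong:
  assumes A: "inj_charts A" and D: "differential_operator A N D"
    and W: "openin (mfd_topology A) W" "W \<subseteq> N" "x \<in> W"
    and f: "smooth_fun A W f" "\<And>y. y \<in> W \<Longrightarrow> f y = g y"
  shows "D f x = D g x"
proof -
  have g: "smooth_fun A W g" by (rule smooth_fun_cong[OF A W(1) f])
  obtain c a m where c: "c \<in> A" "x \<in> fst c"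
    and D_eq: "\<And>f. smooth_fun A W f \<Longrightarrow>
      D f x = (\<Sum>bs | set bs \<subseteq> Basis \<and> length bs \<le> m.
                 a bs * pderivs bs (\<lambda>y. f (chart_inv c y)) (snd c x))"
    by (rule differential_operator_local_formula[OF A D W]) (rule that)
  have "pderivs bs (\<lambda>y. f (chart_inv c y)) (snd c x) = pderivs bs (\<lambda>y. g (chart_inv c y)) (snd c x)" for bs
    using open_chart_image[OF A W(1) c(1)] chart_inv_in(1)[OF A c(1)] f(2) c W(3)
    by (intro pderivs_cong[of "snd c ` (W \<inter> fst c)"]) auto
  then show ?thesis by (simp only: D_eq[OF f(1)] D_eq[OF g])
qed

lemma differential_operator_add:
  assumes A: "inj_charts A" and D: "differential_operator A N D"
    and W: "openin (mfd_topology A) W" "W \<subseteq> N" "x \<in> W"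
    and f: "smooth_fun A W f" and g: "smooth_fun A W g"
  shows "D (\<lambda>y. f y + g y) x = D f x + D g x"
proof -
  obtain c a m where c: "c \<in> A" "x \<in> fst c"
    and D_eq: "\<And>f. smooth_fun A W f \<Longrightarrow>
      D f x = (\<Sum>bs | set bs \<subseteq> Basis \<and> length bs \<le> m.
                 a bs * pderivs bs (\<lambda>y. f (chart_inv c y)) (snd c x))"
    by (rule differential_operator_local_formula[OF A D W]) (rule that)
  have "pderivs bs (\<lambda>y. f (chart_inv c y) + g (chart_inv c y)) (snd c x)
      = pderivs bs (\<lambda>y. f (chart_inv c y)) (snd c x) + pderivs bs (\<lambda>y. g (chart_inv c y)) (snd c x)" for bs
    using open_chart_image[OF A W(1) c(1)] f g c W(3)
    by (intro pderivs_add[of "snd c ` (W \<inter> fst c)"]) (auto simp: smooth_fun_def)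
  then show ?thesis
    using D_eq[OF f] D_eq[OF g] D_eq[OF smooth_fun_add[OF A W(1) f g]]
    by (simp add: distrib_left sum.distrib)
qed


section \<open>The metric bundle and the ambient space as manifolds\<close>

locale conformal_manifold =
  fixes A :: "('m, 'e::euclidean_space) atlas" and C :: "('m \<Rightarrow> 'm form2) set" and p q :: nat
  assumes manifold: "smooth_manifold A"
    and conformal: "conformal_structure A p q C"
begin

abbreviation "\<G> \<equiv> metric_bundle A C"
abbreviation "BA \<equiv> bundle_atlas A C"
abbreviation "AA \<equiv> ambient_atlas A C"

lemma inj_charts_base: "inj_charts A"
  using manifold by (simp add: smooth_manifold_def inj_charts_def)

lemma open_chart_base: "c \<in> A \<Longrightarrow> open (snd c ` fst c)"
  using manifold by (simp add: smooth_manifold_def)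

lemma openin_carrier: "openin (mfd_topology A) (carrier A)"
proof -
  have "carrier A \<inter> fst c = fst c" if "c \<in> A" for c
    using that by (auto simp: carrier_def)
  then show ?thesis
    using inj_charts_base open_chart_base openin_mfd_topology[of A "carrier A"]
    by (auto simp: inj_charts_def)
qed

lemma rescale_in_class:
  assumes "g \<in> C" "smooth_fun A (carrier A) \<Upsilon>"
  shows "rescale \<Upsilon> g \<in> C"
proof -
  obtain g0 where C: "C = {rescale \<Upsilon> g0 | \<Upsilon>. smooth_fun A (carrier A) \<Upsilon>}"
    using conformal by (auto simp: conformal_structure_def)
  then obtain \<Psi> where \<Psi>: "g = rescale \<Psi> g0" "smooth_fun A (carrier A) \<Psi>"
    using assms by auto
  have "rescale \<Upsilon> g = rescale (\<lambda>x. \<Upsilon> x + \<Psi> x) g0"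
    by (simp add: \<Psi> rescale_def fun_eq_iff algebra_simps flip: exp_add)
  then show ?thesis
    using C smooth_fun_add[OF inj_charts_base openin_carrier assms(2) \<Psi>(2)] by blast
qed

lemma class_rescale:
  assumes "g \<in> C" "g' \<in> C"
  obtains \<Upsilon> where "smooth_fun A (carrier A) \<Upsilon>" "g' = rescale \<Upsilon> g"
proof -
  obtain g0 where C: "C = {rescale \<Upsilon> g0 | \<Upsilon>. smooth_fun A (carrier A) \<Upsilon>}"
    using conformal by (auto simp: conformal_structure_def)
  then obtain \<Psi> \<Psi>' where \<Psi>: "g = rescale \<Psi> g0" "smooth_fun A (carrier A) \<Psi>"
    "g' = rescale \<Psi>' g0" "smooth_fun A (carrier A) \<Psi>'"
    using assms by auto
  have "g' = rescale (\<lambda>x. \<Psi>' x + (- 1) * \<Psi> x) g"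
    by (simp add: \<Psi> rescale_def fun_eq_iff algebra_simps flip: exp_add)
  then show ?thesis
    using that smooth_fun_add[OF inj_charts_base openin_carrier \<Psi>(4)
        smooth_fun_cmult[OF inj_charts_base openin_carrier \<Psi>(2)]] by blast
qed

text \<open>Nondegeneracy of the metric is what makes the fibre coordinate well defined: a metric that
  vanished at \<open>x\<close> would be fixed by all dilations.\<close>

lemma metric_nonzero:
  assumes "g \<in> C" "x \<in> carrier A"
  shows "\<exists>v w. g x v w \<noteq> 0"
proof -
  obtain g0 where g0: "pseudo_riemannian_metric A (carrier A) g0"
    and C: "C = {rescale \<Upsilon> g0 | \<Upsilon>. smooth_fun A (carrier A) \<Upsilon>}"
    using conformal by (auto simp: conformal_structure_def)
  obtain \<Psi> where \<Psi>: "g = rescale \<Psi> g0" using assms C by auto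
  obtain c where c: "c \<in> A" "x \<in> fst c" using assms by (auto simp: carrier_def)
  obtain u :: 'e where "u \<noteq> 0" using nonempty_Basis nonzero_Basis by blast
  then obtain v where "components A c g0 (snd c x) u v \<noteq> 0"
    using g0 c assms(2) unfolding pseudo_riemannian_metric_def by blast
  then have "\<exists>v w. g0 x v w \<noteq> 0"
    using chart_inv_chart[OF inj_charts_base c] by (auto simp: components_def Let_def)
  then show ?thesis by (auto simp: \<Psi> rescale_def)
qed

lemma dil_inj:
  assumes "g \<in> C" "x \<in> carrier A" "s > 0" "s' > 0" "dil s (x, g x) = dil s' (x, g x)"
  shows "s = s'"
proof -
  obtain v w where "g x v w \<noteq> 0" using metric_nonzero[OF assms(1,2)] by blast
  moreover have "s\<^sup>2 * g x v w = s'\<^sup>2 * g x v w"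
    using assms(5) by (auto simp: dil_def fun_eq_iff)
  ultimately show ?thesis using assms(3,4) by (simp add: power2_eq_iff_nonneg)
qed

lemma dil_metric_in_bundle:
  assumes "g \<in> C" "x \<in> carrier A" "s > 0"
  shows "dil s (x, g x) \<in> \<G>"
proof -
  have "dil s (x, g x) = (x, rescale (\<lambda>_. ln s) g x)"
    using assms(3) by (simp add: dil_def rescale_def fun_eq_iff exp_double)
  then show ?thesis
    using assms rescale_in_class[OF assms(1) smooth_fun_const[OF inj_charts_base openin_carrier, of "ln s"]]
    by (auto simp: metric_bundle_def)
qed

lemma fibre_coord_dil:
  assumes "g \<in> C" "x \<in> carrier A" "s > 0"
  shows "fibre_coord g (dil s (x, g x)) = s"
  unfolding fibre_coord_def
proof (rule the_equality)
  show "0 < s \<and> dil s (x, g x) = dil s (fst (dil s (x, g x)), g (fst (dil s (x, g x))))"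
    using assms by (simp add: dil_def)
  fix s' assume "0 < s' \<and> dil s (x, g x) = dil s' (fst (dil s (x, g x)), g (fst (dil s (x, g x))))"
  then show "s' = s"
    using dil_inj[OF assms(1,2), of s' s] assms(3) by (simp add: dil_def)
qed

text \<open>Any representative of the class is \<open>e\<^bsup>2\<Upsilon>\<^esup> g\<close>, so a point of \<open>\<G>\<close> over \<open>x\<close> is the dilate of \<open>g(x)\<close>
  by \<open>e\<^bsup>\<Upsilon>(x)\<^esup>\<close>.  This is the trivialization \<open>\<G> \<cong> M \<times> (0, \<infinity>)\<close> given by \<open>g\<close>.\<close>

lemma bundle_cases:
  assumes "g \<in> C" "z \<in> \<G>"
  obtains x s where "x \<in> carrier A" "s > 0" "z = dil s (x, g x)"
proof -
  obtain x g' where x: "z = (x, g' x)" "x \<in> carrier A" "g' \<in> C"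
    using assms by (auto simp: metric_bundle_def)
  obtain \<Upsilon> where "g' = rescale \<Upsilon> g" using class_rescale[OF assms(1) x(3)] by blast
  then have "z = dil (exp (\<Upsilon> x)) (x, g x)"
    by (simp add: x dil_def rescale_def fun_eq_iff exp_double)
  then show ?thesis using that x(2) exp_gt_zero by blast
qed

lemma fst_dil [simp]: "fst (dil s z) = fst z"
  by (simp add: dil_def)

lemma dil_dil: "dil s (dil r z) = dil (s * r) z"
  by (simp add: dil_def power_mult_distrib mult.assoc)

lemma dil_in_bundle:
  assumes "z \<in> \<G>" "s > 0"
  shows "dil s z \<in> \<G>"
proof -
  obtain g where g: "g \<in> C" using assms by (auto simp: metric_bundle_def)
  obtain x r where "x \<in> carrier A" "r > 0" "z = dil r (x, g x)"
    using bundle_cases[OF g assms(1)] by blast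
  then show ?thesis using dil_metric_in_bundle[OF g, of x "s * r"] assms by (simp add: dil_dil)
qed

lemma fibre_coord_pos: "g \<in> C \<Longrightarrow> z \<in> \<G> \<Longrightarrow> fibre_coord g z > 0"
  by (metis bundle_cases fibre_coord_dil)

lemma fibre_coord_eq: "g \<in> C \<Longrightarrow> z \<in> \<G> \<Longrightarrow> z = dil (fibre_coord g z) (fst z, g (fst z))"
  by (metis bundle_cases fibre_coord_dil fst_dil fst_conv)

lemma fibre_coord_homogeneous:
  assumes "g \<in> C" "z \<in> \<G>" "s > 0"
  shows "fibre_coord g (dil s z) = s * fibre_coord g z"
proof -
  obtain x r where x: "x \<in> carrier A" "r > 0" "z = dil r (x, g x)"
    using bundle_cases[OF assms(1,2)] by blast
  then show ?thesis
    using fibre_coord_dil[OF assms(1) x(1)] assms(3) by (simp add: dil_dil)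
qed

lemma dil_rescale: "dil s (x, rescale \<Upsilon> g x) = dil (s * exp (\<Upsilon> x)) (x, g x)"
  by (simp add: dil_def rescale_def fun_eq_iff exp_double power_mult_distrib)

lemma fibre_coord_rescale:
  assumes "g \<in> C" "smooth_fun A (carrier A) \<Upsilon>" "z \<in> \<G>"
  shows "fibre_coord g z = fibre_coord (rescale \<Upsilon> g) z * exp (\<Upsilon> (fst z))"
proof -
  note g' = rescale_in_class[OF assms(1,2)]
  obtain x r where x: "x \<in> carrier A" "r > 0" "z = dil r (x, rescale \<Upsilon> g x)"
    using bundle_cases[OF g' assms(3)] by blast
  have "fibre_coord (rescale \<Upsilon> g) z = r" using fibre_coord_dil[OF g' x(1,2)] x(3) by simp
  moreover have "fibre_coord g z = r * exp (\<Upsilon> x)"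
    using fibre_coord_dil[OF assms(1) x(1), of "r * exp (\<Upsilon> x)"] x by (simp add: dil_rescale)
  ultimately show ?thesis by (simp add: x(3))
qed

lemma bundle_chartE:
  assumes "d \<in> BA"
  obtains c g where "c \<in> A" "g \<in> C"
    "d = (\<G> \<inter> (fst -` fst c), \<lambda>z. (snd c (fst z), fibre_coord g z))"
  using assms by (auto simp: bundle_atlas_def)

lemma ambient_chartE:
  assumes "d \<in> AA"
  obtains b where "b \<in> BA" "d = (fst b \<times> {-1<..<1}, \<lambda>(z, r). (snd b z, r))"
  using assms by (auto simp: ambient_atlas_def)

lemma inj_charts_bundle: "inj_charts BA"
  unfolding inj_charts_def
proof (intro ballI inj_onI)
  fix d z z' assume d: "d \<in> BA" and z: "z \<in> fst d" "z' \<in> fst d" "snd d z = snd d z'"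
  obtain c g where c: "c \<in> A" "g \<in> C"
    "d = (\<G> \<inter> (fst -` fst c), \<lambda>z. (snd c (fst z), fibre_coord g z))"
    using bundle_chartE[OF d] by blast
  have "fst z = fst z'" using z c inj_charts_base by (auto simp: inj_charts_def inj_on_def)
  then show "z = z'"
    using z c fibre_coord_eq[of g z] fibre_coord_eq[of g z'] by auto
qed

lemma inj_charts_ambient: "inj_charts AA"
  unfolding inj_charts_def
proof (intro ballI)
  fix d assume "d \<in> AA"
  then show "inj_on (snd d) (fst d)"
    using inj_charts_bundle by (force simp: inj_charts_def inj_on_def elim!: ambient_chartE)
qed

lemma bundle_chart_image:
  assumes "c \<in> A" "g \<in> C"
  shows "(\<lambda>z. (snd c (fst z), fibre_coord g z)) ` (\<G> \<inter> (fst -` fst c)) = (snd c ` fst c) \<times> {0<..}"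
    (is "?\<phi> ` ?U = _")
proof
  show "?\<phi> ` ?U \<subseteq> (snd c ` fst c) \<times> {0<..}" using fibre_coord_pos[OF assms(2)] by auto
  show "(snd c ` fst c) \<times> {0<..} \<subseteq> ?\<phi> ` ?U"
  proof
    fix y assume "y \<in> (snd c ` fst c) \<times> {0::real<..}"
    then obtain x s where y: "y = (snd c x, s)" and x: "x \<in> fst c" "s > 0" by auto
    then have "x \<in> carrier A" "s > 0" using assms by (auto simp: carrier_def)
    then have *: "dil s (x, g x) \<in> ?U" "?\<phi> (dil s (x, g x)) = (snd c x, s)"
      using dil_metric_in_bundle[OF assms(2)] fibre_coord_dil[OF assms(2)] x by auto
    show "y \<in> ?\<phi> ` ?U" unfolding y by (rule rev_image_eqI[OF *(1)]) (rule *(2)[symmetric])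
  qed
qed

lemma open_bundle_chart: "b \<in> BA \<Longrightarrow> open (snd b ` fst b)"
  by (erule bundle_chartE) (simp add: bundle_chart_image open_chart_base open_Times)

lemma carrier_bundle: "carrier BA = \<G>"
proof
  show "carrier BA \<subseteq> \<G>" by (auto simp: carrier_def bundle_atlas_def)
  show "\<G> \<subseteq> carrier BA"
  proof
    fix z assume z: "z \<in> \<G>"
    then obtain g c where "g \<in> C" "c \<in> A" "fst z \<in> fst c"
      by (auto simp: metric_bundle_def carrier_def)
    then have "(\<G> \<inter> (fst -` fst c), \<lambda>z. (snd c (fst z), fibre_coord g z)) \<in> BA"
      unfolding bundle_atlas_def by blast
    moreover have "z \<in> fst (\<G> \<inter> (fst -` fst c), \<lambda>z. (snd c (fst z), fibre_coord g z))"
      using z \<open>fst z \<in> fst c\<close> by simp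
    ultimately show "z \<in> carrier BA" unfolding carrier_def by blast
  qed
qed

lemma openin_bundle: "openin (mfd_topology BA) \<G>"
proof -
  have "\<G> \<inter> fst b = fst b" if "b \<in> BA" for b
    using that by (auto elim: bundle_chartE)
  then show ?thesis
    using openin_mfd_topology[of BA \<G>] inj_charts_bundle open_bundle_chart carrier_bundle
    by (auto simp: inj_charts_def)
qed

lemma ambient_chart_image:
  "(\<lambda>(z, r). (\<phi> z, r)) ` (U \<times> V) = (\<phi> ` U) \<times> V"
  by force

lemma openin_ambient_space: "openin (mfd_topology AA) (ambient_space A C)"
proof -
  have 1: "ambient_space A C \<inter> fst d = fst d" if "d \<in> AA" for d
    using that by (auto simp: ambient_space_def elim!: ambient_chartE bundle_chartE)
  have 2: "open (snd d ` fst d)" if d: "d \<in> AA" for d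
  proof -
    obtain b where b: "b \<in> BA" "d = (fst b \<times> {-1<..<1}, \<lambda>(z, r). (snd b z, r))"
      using ambient_chartE[OF d] by blast
    show ?thesis using open_bundle_chart[OF b(1)]
      by (simp add: b(2) ambient_chart_image open_Times)
  qed
  have 3: "ambient_space A C \<subseteq> carrier AA"
  proof
    fix z assume "z \<in> ambient_space A C"
    then have "fst z \<in> carrier BA" "snd z \<in> {-1<..<1}"
      by (auto simp: ambient_space_def carrier_bundle)
    then obtain b where b: "b \<in> BA" "z \<in> fst b \<times> {-1<..<1}"
      by (auto simp: carrier_def mem_Times_iff)
    then have "(fst b \<times> {-1<..<1}, \<lambda>(z, r). (snd b z, r)) \<in> AA"
      unfolding ambient_atlas_def by blast
    then show "z \<in> carrier AA"
      unfolding carrier_def by (rule UN_I) (simp only: fst_conv b)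
  qed
  show ?thesis
    using openin_mfd_topology[of AA "ambient_space A C"] inj_charts_ambient 1 2 3
    by (simp add: inj_charts_def)
qed

lemma ambient_nbhd_ambient_space: "ambient_nbhd A C (ambient_space A C)"
  unfolding ambient_nbhd_def
  using openin_ambient_space dil_in_bundle by (auto simp: ambient_space_def adil_def)

lemma ambient_nbhd_Int: "ambient_nbhd A C N \<Longrightarrow> ambient_nbhd A C N' \<Longrightarrow> ambient_nbhd A C (N \<inter> N')"
  unfolding ambient_nbhd_def by blast


section \<open>Densities, their ambient extensions, and scales\<close>

lemma pullback_in_densities:
  assumes "smooth_fun A (carrier A) u"
  shows "(\<lambda>z. u (fst z)) \<in> densities A C 0"
proof -
  have "smooth_fun BA \<G> (\<lambda>z. u (fst z))"
    unfolding smooth_fun_def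
  proof
    fix d assume d: "d \<in> BA"
    obtain c g where c: "c \<in> A" "g \<in> C"
      and dd: "d = (\<G> \<inter> (fst -` fst c), \<lambda>z. (snd c (fst z), fibre_coord g z))"
      using bundle_chartE[OF d] by blast
    let ?S = "snd d ` (\<G> \<inter> fst d)"
    have S: "?S = (snd c ` fst c) \<times> {0<..}"
      using bundle_chart_image[OF c] by (simp add: dd)
    have "carrier A \<inter> fst c = fst c" using c by (auto simp: carrier_def)
    then have "smooth_on (snd c ` fst c) (\<lambda>y. u (chart_inv c y))"
      using assms c by (metis smooth_fun_def)
    then have *: "smooth_on ?S (\<lambda>y. u (chart_inv c (fst y)))"
      using S open_chart_base[OF c(1)] open_chart_image[OF inj_charts_bundle openin_bundle d]
      by (intro smooth_on_compose_linear[of "snd c ` fst c" ?S fst]) (auto simp: bounded_linear_fst)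
    have **: "chart_inv c (fst y) = fst (chart_inv d y)" if y: "y \<in> ?S" for y
    proof -
      obtain z where z: "chart_inv d y = z" by simp
      have "fst z \<in> fst c" "fst y = snd c (fst z)"
        using chart_inv_in[OF inj_charts_bundle d y] unfolding z by (auto simp: dd)
      then show ?thesis
        using chart_inv_chart[OF inj_charts_base c(1)] by (simp add: z)
    qed
    show "smooth_on ?S (\<lambda>y. u (fst (chart_inv d y)))"
      by (rule smooth_on_cong[OF open_chart_image[OF inj_charts_bundle openin_bundle d] *])
        (simp only: **)
  qed
  then show ?thesis by (simp add: densities_def)
qed

lemma const_in_densities: "(\<lambda>_. k) \<in> densities A C 0"
  using pullback_in_densities[OF smooth_fun_const[OF inj_charts_base openin_carrier, of k]] by simp

lemma const_in_ambient_densities: "(\<lambda>_. k) \<in> ambient_densities A C 0"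
  unfolding ambient_densities_def
  using ambient_nbhd_ambient_space smooth_fun_const[OF inj_charts_ambient openin_ambient_space] by force

text \<open>A scale exists: extend the fibre coordinate of \<open>g\<close> to be constant in the last variable.  In a
  chart built from another representative \<open>e\<^bsup>2\<Upsilon>\<^esup> g\<close> it is the fibre coordinate of the chart times
  the smooth factor \<open>e\<^bsup>\<Upsilon>\<^esup>\<close>.\<close>

lemma ambient_scale_fibre_coord:
  assumes g: "g \<in> C"
  shows "ambient_scale A C g (\<lambda>z. fibre_coord g (fst z))"
proof -
  let ?t = "\<lambda>z. fibre_coord g (fst z)" and ?N = "ambient_space A C"
  have "smooth_fun AA ?N ?t"
    unfolding smooth_fun_def
  proof
    fix d assume d: "d \<in> AA"
    obtain b where b: "b \<in> BA" and dd: "d = (fst b \<times> {-1<..<1}, \<lambda>(z, r). (snd b z, r))"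
      using ambient_chartE[OF d] by blast
    obtain c g' where c: "c \<in> A" "g' \<in> C"
      and bb: "b = (\<G> \<inter> (fst -` fst c), \<lambda>z. (snd c (fst z), fibre_coord g' z))"
      using bundle_chartE[OF b] by blast
    obtain \<Upsilon> where \<Upsilon>: "smooth_fun A (carrier A) \<Upsilon>" "g' = rescale \<Upsilon> g"
      using class_rescale[OF g c(2)] by blast
    let ?S = "snd d ` (?N \<inter> fst d)"
    note oS = open_chart_image[OF inj_charts_ambient openin_ambient_space d]
    have "carrier A \<inter> fst c = fst c" using c by (auto simp: carrier_def)
    then have "smooth_on (snd c ` fst c) (\<lambda>y. \<Upsilon> (chart_inv c y))"
      using \<Upsilon>(1) c by (metis smooth_fun_def)
    moreover have "(\<lambda>y. fst (fst y)) ` ?S \<subseteq> snd c ` fst c" by (auto simp: dd bb)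
    ultimately have "smooth_on ?S (\<lambda>y. \<Upsilon> (chart_inv c (fst (fst y))))"
      using open_chart_base[OF c(1)] oS
      by (intro smooth_on_compose_linear[of "snd c ` fst c" ?S "\<lambda>y. fst (fst y)"])
        (auto intro: bounded_linear_compose[OF bounded_linear_fst bounded_linear_fst])
    moreover have "smooth_on ?S (\<lambda>y. snd (fst y))"
      by (intro smooth_on_linear oS bounded_linear_compose[OF bounded_linear_snd bounded_linear_fst])
    ultimately have *: "smooth_on ?S (\<lambda>y. snd (fst y) * exp (\<Upsilon> (chart_inv c (fst (fst y)))))"
      by (intro smooth_on_mult smooth_on_exp oS)
    have **: "snd (fst y) * exp (\<Upsilon> (chart_inv c (fst (fst y)))) = ?t (chart_inv d y)"
      if y: "y \<in> ?S" for y
    proof -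
      obtain z r where z: "chart_inv d y = (z, r)" by (rule prod.exhaust)
      have "z \<in> \<G>" "fst z \<in> fst c" "y = ((snd c (fst z), fibre_coord g' z), r)"
        using chart_inv_in[OF inj_charts_ambient d y] z by (auto simp: dd bb)
      then show ?thesis
        using fibre_coord_rescale[OF g \<Upsilon>(1), of z] chart_inv_chart[OF inj_charts_base c(1)]
        unfolding z by (simp add: \<Upsilon>(2))
    qed
    show "smooth_on ?S (\<lambda>y. ?t (chart_inv d y))"
      by (rule smooth_on_cong[OF oS *]) (rule **)
  qed
  moreover have "?t (adil s z) = s powr 1 * ?t z" if "s > 0" "z \<in> ?N" for s z
    using that fibre_coord_homogeneous[OF g] by (auto simp: ambient_space_def adil_def)
  ultimately have "?t \<in> ambient_densities A C 1"
    unfolding ambient_densities_def using ambient_nbhd_ambient_space by blast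
  moreover have "\<forall>z\<in>?N. ?t z > 0"
    using fibre_coord_pos[OF g] by (auto simp: ambient_space_def)
  ultimately show ?thesis
    using ambient_nbhd_ambient_space fibre_coord_dil[OF g] unfolding ambient_scale_def by auto
qed

text \<open>Smoothness, positivity and homogeneity of a scale may hold on different neighbourhoods of \<open>\<G>\<close>;
  the logarithm is controlled on their intersection.\<close>

lemma ambient_scaleE:
  assumes "ambient_scale A C g t"
  obtains N where "ambient_nbhd A C N" "smooth_fun AA N (\<lambda>z. ln (t z))"
    "\<And>s z. s > 0 \<Longrightarrow> z \<in> N \<Longrightarrow> ln (t (adil s z)) = ln s + ln (t z)"
proof -
  obtain N1 where N1: "ambient_nbhd A C N1" "smooth_fun AA N1 t"
    "\<And>s z. s > 0 \<Longrightarrow> z \<in> N1 \<Longrightarrow> t (adil s z) = s * t z"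
    using assms by (auto simp: ambient_scale_def ambient_densities_def)
  obtain N2 where N2: "ambient_nbhd A C N2" "\<And>z. z \<in> N2 \<Longrightarrow> t z > 0"
    using assms by (auto simp: ambient_scale_def)
  have N: "ambient_nbhd A C (N1 \<inter> N2)" using N1 N2 ambient_nbhd_Int by blast
  show ?thesis
  proof (rule that[OF N])
    show "smooth_fun AA (N1 \<inter> N2) (\<lambda>z. ln (t z))"
      using N smooth_fun_subset[OF N1(2)] N2(2)
      by (intro smooth_fun_ln inj_charts_ambient) (auto simp: ambient_nbhd_def)
    show "ln (t (adil s z)) = ln s + ln (t z)" if "s > 0" "z \<in> N1 \<inter> N2" for s z
      using that N1(3) N2(2)[of z] by (simp add: ln_mult)
  qed
qed

text \<open>On \<open>\<G>\<close> itself a scale for \<open>g\<close> is the fibre coordinate of \<open>g\<close>, so scales for \<open>g\<close> and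
  \<open>e\<^bsup>2\<Upsilon>\<^esup> g\<close> differ there by the factor \<open>e\<^bsup>\<Upsilon>\<^esup>\<close>.\<close>

lemma ln_scale_rescale:
  assumes g: "g \<in> C" and \<Upsilon>: "smooth_fun A (carrier A) \<Upsilon>"
    and t: "ambient_scale A C g t" and t': "ambient_scale A C (rescale \<Upsilon> g) t'"
    and z: "z \<in> \<G>"
  shows "ln (t' (z, 0)) - ln (t (z, 0)) = - \<Upsilon> (fst z)"
proof -
  obtain x r where x: "x \<in> carrier A" "r > 0" "z = dil r (x, rescale \<Upsilon> g x)"
    using bundle_cases[OF rescale_in_class[OF g \<Upsilon>] z] by blast
  have "t' (z, 0) = r" using t' x by (simp add: ambient_scale_def)
  moreover have "t (z, 0) = r * exp (\<Upsilon> x)"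
    using t x dil_rescale by (metis ambient_scale_def exp_gt_zero mult_pos_pos)
  ultimately show ?thesis using x by (simp add: ln_mult)
qed

end


section \<open>The transformation law\<close>

locale ambient_operator = conformal_manifold A C p q
  for A :: "('m, 'e::euclidean_space) atlas" and C p q +
  fixes N :: "'m apoint set" and w :: real
    and P :: "('m mpoint \<Rightarrow> real) \<Rightarrow> 'm mpoint \<Rightarrow> real"
    and Pt :: "('m apoint \<Rightarrow> real) \<Rightarrow> 'm apoint \<Rightarrow> real"
  assumes nbhd: "ambient_nbhd A C N"
    and invariant: "invariant_differential_operator A C 0 w P"
    and extension: "ambient_extension A C N 0 w P Pt"
begin

lemma P_linear:
  assumes "f \<in> densities A C 0" "z \<in> \<G>"
  shows "P (\<lambda>z. a * f z) z = a * P f z"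
proof -
  have "P (\<lambda>z. a * f z + 0 * f z) z = a * P f z + 0 * P f z"
    using invariant assms unfolding invariant_differential_operator_def by blast
  then show ?thesis by simp
qed

lemma P_cong:
  assumes "f \<in> densities A C 0" "f' \<in> densities A C 0" "\<And>z. z \<in> \<G> \<Longrightarrow> f z = f' z" "z \<in> \<G>"
  shows "P f z = P f' z"
  using invariant assms unfolding invariant_differential_operator_def by blast

lemma Pt_restricts:
  assumes "F \<in> ambient_densities A C 0" "f \<in> densities A C 0" "\<And>z. z \<in> \<G> \<Longrightarrow> F (z, 0) = f z" "z \<in> \<G>"
  shows "Pt F (z, 0) = P f z"
  using extension assms unfolding ambient_extension_def by blast

lemma Pt_differential_operator: "differential_operator AA N Pt"
  using extension by (simp add: ambient_extension_def)

text \<open>The factors \<open>s\<close> by which a dilation multiplies \<open>t\<close> and \<open>t'\<close> cancel in \<open>log t' - log t\<close>, which is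
  therefore an ambient density of weight \<open>0\<close>; \<open>Pt\<close> sees only its restriction \<open>-\<Upsilon>\<close> to \<open>\<G>\<close>.\<close>

lemma Pt_ln_scale_rescale:
  assumes g: "g \<in> C" and \<Upsilon>: "smooth_fun A (carrier A) \<Upsilon>"
    and t: "ambient_scale A C g t" and t': "ambient_scale A C (rescale \<Upsilon> g) t'"
    and z: "z \<in> \<G>"
  shows "Pt (\<lambda>y. ln (t' y)) (z, 0) = Pt (\<lambda>y. ln (t y)) (z, 0) - P (\<lambda>z. \<Upsilon> (fst z)) z"
proof -
  let ?F = "\<lambda>y. ln (t' y) + (- 1) * ln (t y)"
  obtain N1 where N1: "ambient_nbhd A C N1" "smooth_fun AA N1 (\<lambda>z. ln (t z))"
    "\<And>s z. s > 0 \<Longrightarrow> z \<in> N1 \<Longrightarrow> ln (t (adil s z)) = ln s + ln (t z)"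
    using ambient_scaleE[OF t] by metis
  obtain N2 where N2: "ambient_nbhd A C N2" "smooth_fun AA N2 (\<lambda>z. ln (t' z))"
    "\<And>s z. s > 0 \<Longrightarrow> z \<in> N2 \<Longrightarrow> ln (t' (adil s z)) = ln s + ln (t' z)"
    using ambient_scaleE[OF t'] by metis
  let ?W = "N1 \<inter> N2 \<inter> N"
  have W: "ambient_nbhd A C ?W" using N1 N2 nbhd ambient_nbhd_Int by blast
  then have oW: "openin (mfd_topology AA) ?W" "(z, 0) \<in> ?W"
    using z by (auto simp: ambient_nbhd_def)
  have st: "smooth_fun AA ?W (\<lambda>z. ln (t z))" "smooth_fun AA ?W (\<lambda>z. ln (t' z))"
    by (auto intro: smooth_fun_subset[OF N1(2)] smooth_fun_subset[OF N2(2)])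
  have F: "smooth_fun AA ?W ?F"
    by (intro smooth_fun_add smooth_fun_cmult inj_charts_ambient oW st)
  have "?F (adil s y) = s powr 0 * ?F y" if "s > 0" "y \<in> ?W" for s y
    using that N1(3) N2(3) by simp
  then have "?F \<in> ambient_densities A C 0"
    unfolding ambient_densities_def using W F by blast
  moreover have "?F (z, 0) = - 1 * \<Upsilon> (fst z)" if "z \<in> \<G>" for z
    using ln_scale_rescale[OF g \<Upsilon> t t' that] by simp
  moreover have "(\<lambda>z. - 1 * \<Upsilon> (fst z)) \<in> densities A C 0"
    by (rule pullback_in_densities[OF smooth_fun_cmult[OF inj_charts_base openin_carrier \<Upsilon>]])
  ultimately have "Pt ?F (z, 0) = P (\<lambda>z. - 1 * \<Upsilon> (fst z)) z"
    using z by (intro Pt_restricts) auto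
  also have "\<dots> = - P (\<lambda>z. \<Upsilon> (fst z)) z"
    using P_linear[OF pullback_in_densities[OF \<Upsilon>] z, of "- 1"] by simp
  finally have "Pt ?F (z, 0) = - P (\<lambda>z. \<Upsilon> (fst z)) z" .
  moreover have "Pt (\<lambda>y. ln (t y) + ?F y) (z, 0) = Pt (\<lambda>y. ln (t y)) (z, 0) + Pt ?F (z, 0)"
    by (rule differential_operator_add[OF inj_charts_ambient Pt_differential_operator oW(1) _ oW(2) st(1) F])
      simp
  ultimately show ?thesis by simp
qed

text \<open>Two scales for the same \<open>g\<close> are the case \<open>\<Upsilon> = 0\<close>.\<close>

lemma log_curvature_unique:
  assumes g: "g \<in> C" and t: "ambient_scale A C g t" and t': "ambient_scale A C g t'"
    and x: "x \<in> carrier A"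
  shows "log_curvature Pt g t x = log_curvature Pt g t' x"
proof -
  have z: "(x, g x) \<in> \<G>" using g x by (auto simp: metric_bundle_def)
  have "rescale (\<lambda>_. 0) g = g" by (simp add: rescale_def)
  then have "Pt (\<lambda>y. ln (t' y)) ((x, g x), 0) = Pt (\<lambda>y. ln (t y)) ((x, g x), 0) - P (\<lambda>_. 0) (x, g x)"
    using Pt_ln_scale_rescale[OF g smooth_fun_const[OF inj_charts_base openin_carrier, of 0] t _ z] t'
    by simp
  moreover have "P (\<lambda>_. 0) (x, g x) = 0"
    using P_linear[OF const_in_densities z, of 0 0] by simp
  ultimately show ?thesis by (simp add: log_curvature_def)
qed

lemma Q_curvature_eq:
  assumes "g \<in> C" "ambient_scale A C g t" "x \<in> carrier A"
  shows "Q_curvature A C Pt g x = log_curvature Pt g t x"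
  unfolding Q_curvature_def
  by (rule log_curvature_unique[OF assms(1) someI[of "ambient_scale A C g", OF assms(2)] assms(2,3)])

text \<open>Under a dilation \<open>log t\<close> only changes by the constant \<open>log s\<close>, which \<open>Pt\<close> kills along \<open>\<G>\<close> when
  \<open>P 1 = 0\<close>; hence \<open>Pt (log t)\<close> is homogeneous of degree \<open>w\<close> on \<open>\<G>\<close>.\<close>

lemma Pt_ln_scale_homogeneous:
  assumes t: "ambient_scale A C g t" and P1: "\<And>z. z \<in> \<G> \<Longrightarrow> P (\<lambda>_. 1) z = 0"
    and s: "s > 0" and z: "z \<in> \<G>"
  shows "Pt (\<lambda>y. ln (t y)) (dil s z, 0) = s powr w * Pt (\<lambda>y. ln (t y)) (z, 0)"
proof -
  obtain N1 where N1: "ambient_nbhd A C N1" "smooth_fun AA N1 (\<lambda>z. ln (t z))"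
    "\<And>s z. s > 0 \<Longrightarrow> z \<in> N1 \<Longrightarrow> ln (t (adil s z)) = ln s + ln (t z)"
    using ambient_scaleE[OF t] by metis
  let ?W = "N1 \<inter> N"
  have W: "ambient_nbhd A C ?W" using N1 nbhd ambient_nbhd_Int by blast
  have oW: "openin (mfd_topology AA) ?W" "(z, 0) \<in> ?W"
    using W z by (auto simp: ambient_nbhd_def)
  have dW: "adil s (z, 0) \<in> ?W"
    using W s oW(2) unfolding ambient_nbhd_def by blast
  have st: "smooth_fun AA ?W (\<lambda>z. ln (t z))"
    by (auto intro: smooth_fun_subset[OF N1(2)])
  note const = smooth_fun_const[OF inj_charts_ambient oW(1), of "ln s"]
  have "Pt (\<lambda>y. ln (t y)) (adil s (z, 0)) = s powr (w - 0) * Pt (\<lambda>y. ln (t (adil s y))) (z, 0)"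
    using extension s oW dW st unfolding ambient_extension_def by blast
  also have "Pt (\<lambda>y. ln (t (adil s y))) (z, 0) = Pt (\<lambda>y. ln s + ln (t y)) (z, 0)"
    by (rule differential_operator_cong[OF inj_charts_ambient Pt_differential_operator oW(1) _ oW(2)
          smooth_fun_add[OF inj_charts_ambient oW(1) const st], symmetric])
      (use N1(3) s in auto)
  also have "\<dots> = Pt (\<lambda>_. ln s) (z, 0) + Pt (\<lambda>y. ln (t y)) (z, 0)"
    by (rule differential_operator_add[OF inj_charts_ambient Pt_differential_operator oW(1) _ oW(2) const st])
      simp
  also have "Pt (\<lambda>_. ln s) (z, 0) = P (\<lambda>_. ln s) z"
    by (rule Pt_restricts[OF const_in_ambient_densities const_in_densities _ z]) simp
  also have "\<dots> = 0"
    using P_linear[OF const_in_densities z, of "ln s" 1] P1[OF z] by simp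
  finally show ?thesis by (simp add: adil_def)
qed

lemma op_at_zero:
  assumes g: "g \<in> C" and \<Upsilon>: "smooth_fun A (carrier A) \<Upsilon>" and x: "x \<in> carrier A"
  shows "op_at 0 P g \<Upsilon> x = P (\<lambda>z. \<Upsilon> (fst z)) (x, g x)"
proof -
  have z: "(x, g x) \<in> \<G>" using g x by (auto simp: metric_bundle_def)
  have eq: "\<Upsilon> (fst z) = density_of 0 g \<Upsilon> z" if "z \<in> \<G>" for z
    using fibre_coord_pos[OF g that] by (simp add: density_of_def)
  have "smooth_fun BA \<G> (\<lambda>z. \<Upsilon> (fst z))"
    using pullback_in_densities[OF \<Upsilon>] by (simp add: densities_def)
  then have "smooth_fun BA \<G> (density_of 0 g \<Upsilon>)"
    by (rule smooth_fun_cong[OF inj_charts_bundle openin_bundle _ eq])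
  moreover have "density_of 0 g \<Upsilon> (dil s z) = s powr 0 * density_of 0 g \<Upsilon> z" if "s > 0" "z \<in> \<G>" for s z
    using that eq[of z] eq[OF dil_in_bundle[OF that(2,1)]] by simp
  ultimately have "density_of 0 g \<Upsilon> \<in> densities A C 0"
    by (simp add: densities_def)
  then have "P (\<lambda>z. \<Upsilon> (fst z)) (x, g x) = P (density_of 0 g \<Upsilon>) (x, g x)"
    by (rule P_cong[OF pullback_in_densities[OF \<Upsilon>] _ eq z])
  then show ?thesis by (simp add: op_at_def)
qed

lemma Q_curvature_rescale:
  assumes g: "g \<in> C" and \<Upsilon>: "smooth_fun A (carrier A) \<Upsilon>" and x: "x \<in> carrier A"
    and P1: "\<And>z. z \<in> \<G> \<Longrightarrow> P (\<lambda>_. 1) z = 0"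
  shows "exp (- w * \<Upsilon> x) * Q_curvature A C Pt (rescale \<Upsilon> g) x
       = Q_curvature A C Pt g x + op_at 0 P g \<Upsilon> x"
proof -
  let ?z = "(x, g x)" and ?z' = "(x, rescale \<Upsilon> g x)"
  note g' = rescale_in_class[OF g \<Upsilon>]
  obtain t t' where t: "ambient_scale A C g t" and t': "ambient_scale A C (rescale \<Upsilon> g) t'"
    using ambient_scale_fibre_coord g g' by blast
  have z: "?z \<in> \<G>" "?z' \<in> \<G>" using g g' x by (auto simp: metric_bundle_def)
  have z': "?z' = dil (exp (\<Upsilon> x)) ?z" using dil_rescale[of 1 x \<Upsilon> g] by (simp add: dil_def)
  have ew: "exp (\<Upsilon> x) powr w = exp (w * \<Upsilon> x)" by (simp add: powr_def)
  have "P (\<lambda>z. \<Upsilon> (fst z)) \<in> densities A C w"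
    using invariant pullback_in_densities[OF \<Upsilon>] by (auto simp: invariant_differential_operator_def)
  then have "P (\<lambda>z. \<Upsilon> (fst z)) ?z' = exp (w * \<Upsilon> x) * P (\<lambda>z. \<Upsilon> (fst z)) ?z"
    using z by (simp add: densities_def z' ew)
  moreover have "Pt (\<lambda>y. ln (t y)) (?z', 0) = exp (w * \<Upsilon> x) * Pt (\<lambda>y. ln (t y)) (?z, 0)"
    using Pt_ln_scale_homogeneous[OF t P1 _ z(1), of "exp (\<Upsilon> x)"] by (simp add: z' ew)
  \<comment> \<open>Both terms of \<open>Pt (log t) - P \<Upsilon>\<close> at \<open>g'(x)\<close> are now expressed by their values at \<open>g(x)\<close>.\<close>
  ultimately have "Q_curvature A C Pt (rescale \<Upsilon> g) x
      = exp (w * \<Upsilon> x) * (Q_curvature A C Pt g x + op_at 0 P g \<Upsilon> x)"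
    using Pt_ln_scale_rescale[OF g \<Upsilon> t t' z(2)]
    by (simp add: Q_curvature_eq[OF g t x] Q_curvature_eq[OF g' t' x] log_curvature_def
        op_at_zero[OF g \<Upsilon> x] algebra_simps)
  then show ?thesis by (simp add: exp_minus)
qed

end

theorem theorem2p2:
  fixes A :: "('m, 'e::euclidean_space) atlas"
    and C :: "('m \<Rightarrow> 'm form2) set"
    and N :: "'m apoint set"
    and h :: "'m apoint \<Rightarrow> 'm apoint form2"
    and P :: "('m mpoint \<Rightarrow> real) \<Rightarrow> 'm mpoint \<Rightarrow> real"
    and Pt :: "('m apoint \<Rightarrow> real) \<Rightarrow> 'm apoint \<Rightarrow> real"
    and p q :: nat and w :: real
  assumes "smooth_manifold A" and "DIM('e) \<ge> 3"
    and "conformal_structure A p q C"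
    and "ambient_metric A C N h"
    and "invariant_differential_operator A C 0 w P"
    and "ambient_extension A C N 0 w P Pt"
  shows "(\<forall>g\<in>C.
           (\<exists>t. ambient_scale A C g t) \<and>
           (\<forall>t t'. ambient_scale A C g t \<longrightarrow> ambient_scale A C g t' \<longrightarrow>
              (\<forall>x\<in>carrier A. log_curvature Pt g t x = log_curvature Pt g t' x)) \<and>
           (\<forall>t. ambient_scale A C g t \<longrightarrow>
              (\<forall>x\<in>carrier A. Q_curvature A C Pt g x = log_curvature Pt g t x))) \<and>
         ((\<forall>z\<in>metric_bundle A C. P (\<lambda>_. 1) z = 0) \<longrightarrow>
         (\<forall>g\<in>C. \<forall>\<Upsilon> g'. smooth_fun A (carrier A) \<Upsilon> \<longrightarrow> g' = rescale \<Upsilon> g \<longrightarrow>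
            (\<forall>x\<in>carrier A.
               exp (- w * \<Upsilon> x) * Q_curvature A C Pt g' x
                 = Q_curvature A C Pt g x + op_at 0 P g \<Upsilon> x)))"
proof -
  interpret ambient_operator A C p q N w P Pt
    using assms by unfold_locales (auto simp: ambient_metric_def)
  show ?thesis
    using ambient_scale_fibre_coord log_curvature_unique Q_curvature_eq Q_curvature_rescale by blast
qed

end
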